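(* Let $n\ge 1$ be an integer and let $V_{8n}=\langle a,b : a^{2n}=b^4=1,\ ba=a^{-1}b^{-1},\ b^{-1}a=a^{-1}b\rangle$. Then each of the graphs $\Gamma=\mathrm{ESCom}(V_{8n})$, $\Gamma=\mathrm{CSCom}(V_{8n})$ and $\Gamma=\mathrm{OSCom}(V_{8n})$ satisfies the Hansen--Vukičević inequality \[ \frac{M_2(\Gamma)}{|e(\Gamma)|}\ \ge\ \frac{M_1(\Gamma)}{|v(\Gamma)|}. \]
   Context: For an equivalence relation $B$ on a finite group $G$, with $[g]$ the class of $g$, the $B$ super commuting graph of $G$ is the simple graph with vertex set $G$ in which two distinct vertices $g,h$ are adjacent if and only if $[g]=[h]$ or there exist $g'\in[g]$, $h'\in[h]$ with $g'h'=h'g'$. It is denoted $\mathrm{ESCom}(G)$ when $B$ is equality (so $g\ne h$ are adjacent iff $gh=hg$), $\mathrm{CSCom}(G)$ when $B$ is conjugacy in $G$, and $\mathrm{OSCom}(G)$ when $B$ is the relation of having the same order. For a finite simple graph $\Gamma$ with vertex set $v(\Gamma)$ and edge set $e(\Gamma)$, the first and second Zagreb indices are $M_1(\Gamma)=\sum_{v\in v(\Gamma)}\deg(v)^2$ and $M_2(\Gamma)=\sum_{uv\in e(\Gamma)}\deg(u)\deg(v)$. *)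

theory Defs
  imports Complex_Main "HOL-Algebra.Multiplicative_Group"
begin

section \<open>Groups given by generators and relations\<close>

datatype 'g letter = Gen 'g | Inv 'g

type_synonym 'g word = "'g letter list"

text \<open>
  The congruence on words over the generators and their formal inverses that is generated by
  free cancellation and by the relations \<open>u = v\<close> for \<open>(u, v) \<in> R\<close>; its classes form
  the group \<open>\<langle>UNIV :: 'g set | R\<rangle>\<close>.
\<close>

inductive pres_eq :: "('g word \<times> 'g word) set \<Rightarrow> 'g word \<Rightarrow> 'g word \<Rightarrow> bool"
  for R where
  refl: "pres_eq R u u"
| sym: "pres_eq R u v \<Longrightarrow> pres_eq R v u"
| trans: "pres_eq R u v \<Longrightarrow> pres_eq R v w \<Longrightarrow> pres_eq R u w"
| append: "pres_eq R u u' \<Longrightarrow> pres_eq R v v' \<Longrightarrow> pres_eq R (u @ v) (u' @ v')"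
| gen_inv: "pres_eq R [Gen x, Inv x] []"
| inv_gen: "pres_eq R [Inv x, Gen x] []"
| rel: "(u, v) \<in> R \<Longrightarrow> pres_eq R u v"

definition pres_class :: "('g word \<times> 'g word) set \<Rightarrow> 'g word \<Rightarrow> 'g word set" where
  "pres_class R u = {v. pres_eq R u v}"

definition presented_group :: "('g word \<times> 'g word) set \<Rightarrow> 'g word set monoid" where
  "presented_group R =
     \<lparr>carrier = range (pres_class R),
      mult = (\<lambda>X Y. {w. \<exists>u\<in>X. \<exists>v\<in>Y. pres_eq R (u @ v) w}),
      one = pres_class R []\<rparr>"

lemma pres_class_eq_iff: "pres_class R u = pres_class R v \<longleftrightarrow> pres_eq R u v"
  unfolding pres_class_def by (auto intro: pres_eq.intros)

lemma presented_group_mult: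
  "pres_class R u \<otimes>\<^bsub>presented_group R\<^esub> pres_class R v = pres_class R (u @ v)"
  unfolding presented_group_def pres_class_def
  by (auto intro: pres_eq.refl pres_eq.trans[OF pres_eq.append])

fun inv_letter :: "'g letter \<Rightarrow> 'g letter" where
  "inv_letter (Gen x) = Inv x"
| "inv_letter (Inv x) = Gen x"

lemma pres_eq_inverse_word: "pres_eq R (rev (map inv_letter u) @ u) []"
proof (induction u)
  case Nil
  show ?case by (simp add: pres_eq.refl)
next
  case (Cons l u)
  have "pres_eq R [inv_letter l, l] []"
    by (cases l) (auto intro: pres_eq.intros)
  then have "pres_eq R (rev (map inv_letter u) @ [inv_letter l, l] @ u)
      (rev (map inv_letter u) @ [] @ u)"
    by (intro pres_eq.append pres_eq.refl)
  with Cons.IH show ?case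
    by (auto intro: pres_eq.trans)
qed

lemma group_presented_group: "group (presented_group R)"
proof (rule groupI)
  have car: "carrier (presented_group R) = range (pres_class R)"
    and one: "\<one>\<^bsub>presented_group R\<^esub> = pres_class R []"
    by (simp_all add: presented_group_def)
  show "\<one>\<^bsub>presented_group R\<^esub> \<in> carrier (presented_group R)"
    by (simp add: car one)
  fix X assume "X \<in> carrier (presented_group R)"
  then obtain u where X: "X = pres_class R u" by (auto simp: car)
  show "\<one>\<^bsub>presented_group R\<^esub> \<otimes>\<^bsub>presented_group R\<^esub> X = X"
    by (simp add: X one presented_group_mult)
  have "pres_class R (rev (map inv_letter u)) \<otimes>\<^bsub>presented_group R\<^esub> X =
      \<one>\<^bsub>presented_group R\<^esub>"
    by (simp add: X one presented_group_mult pres_class_eq_iff pres_eq_inverse_word)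
  then show "\<exists>Y\<in>carrier (presented_group R).
      Y \<otimes>\<^bsub>presented_group R\<^esub> X = \<one>\<^bsub>presented_group R\<^esub>"
    by (auto simp: car)
next
  show "X \<otimes>\<^bsub>presented_group R\<^esub> Y \<in> carrier (presented_group R)"
    if "X \<in> carrier (presented_group R)" "Y \<in> carrier (presented_group R)" for X Y
    using that by (auto simp: presented_group_def presented_group_mult[unfolded presented_group_def, simplified])
  show "X \<otimes>\<^bsub>presented_group R\<^esub> Y \<otimes>\<^bsub>presented_group R\<^esub> Z =
      X \<otimes>\<^bsub>presented_group R\<^esub> (Y \<otimes>\<^bsub>presented_group R\<^esub> Z)"
    if "X \<in> carrier (presented_group R)" "Y \<in> carrier (presented_group R)"
      "Z \<in> carrier (presented_group R)" for X Y Z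
  proof -
    from that obtain u v w where "X = pres_class R u" "Y = pres_class R v" "Z = pres_class R w"
      by (auto simp: presented_group_def)
    then show ?thesis by (simp add: presented_group_mult)
  qed
qed

section \<open>The groups \<open>V\<^sub>8\<^sub>n\<close>\<close>

datatype V_generator = gen_a | gen_b

text \<open>The argument is \<open>n\<close>, not the order \<open>8n\<close>.\<close>

definition V8 :: "nat \<Rightarrow> V_generator word set monoid" where
  "V8 n = presented_group
     {(replicate (2 * n) (Gen gen_a), []),
      (replicate 4 (Gen gen_b), []),
      ([Gen gen_b, Gen gen_a], [Inv gen_a, Inv gen_b]),
      ([Inv gen_b, Gen gen_a], [Inv gen_a, Gen gen_b])}"

section \<open>Simple graphs and Zagreb indices\<close>

text \<open>A simple graph has edges \<open>{u, v}\<close> with \<open>u \<noteq> v\<close>; nothing in the type enforces this.\<close>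

record 'v sgraph =
  vertices :: "'v set"
  edges :: "'v set set"

definition degree :: "'v sgraph \<Rightarrow> 'v \<Rightarrow> nat" where
  "degree \<Gamma> v = card {e \<in> edges \<Gamma>. v \<in> e}"

definition zagreb1 :: "'v sgraph \<Rightarrow> nat" where
  "zagreb1 \<Gamma> = (\<Sum>v\<in>vertices \<Gamma>. (degree \<Gamma> v)\<^sup>2)"

text \<open>The product over an edge \<open>e = {u, v}\<close> is \<open>deg u * deg v\<close>.\<close>

definition zagreb2 :: "'v sgraph \<Rightarrow> nat" where
  "zagreb2 \<Gamma> = (\<Sum>e\<in>edges \<Gamma>. \<Prod>v\<in>e. degree \<Gamma> v)"

definition hansen_vukicevic :: "'v sgraph \<Rightarrow> bool" where
  "hansen_vukicevic \<Gamma> \<longleftrightarrow>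
     real (zagreb2 \<Gamma>) / real (card (edges \<Gamma>)) \<ge> real (zagreb1 \<Gamma>) / real (card (vertices \<Gamma>))"

section \<open>Super commuting graphs\<close>

text \<open>For an equivalence relation \<open>B\<close> on the carrier, \<open>B `` {g}\<close> is the class of \<open>g\<close>.\<close>

definition super_commuting_graph :: "('a, 'm) monoid_scheme \<Rightarrow> 'a rel \<Rightarrow> 'a sgraph" where
  "super_commuting_graph G B =
     \<lparr>vertices = carrier G,
      edges = {{g, h} | g h. g \<in> carrier G \<and> h \<in> carrier G \<and> g \<noteq> h \<and>
        (B `` {g} = B `` {h} \<or>
         (\<exists>g'\<in>B `` {g}. \<exists>h'\<in>B `` {h}. g' \<otimes>\<^bsub>G\<^esub> h' = h' \<otimes>\<^bsub>G\<^esub> g'))}\<rparr>"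

definition conj_rel :: "('a, 'm) monoid_scheme \<Rightarrow> 'a rel" where
  "conj_rel G = {(g, h). g \<in> carrier G \<and> h \<in> carrier G \<and>
     (\<exists>x\<in>carrier G. h = x \<otimes>\<^bsub>G\<^esub> g \<otimes>\<^bsub>G\<^esub> inv\<^bsub>G\<^esub> x)}"

definition same_order_rel :: "('a, 'm) monoid_scheme \<Rightarrow> 'a rel" where
  "same_order_rel G = {(g, h). g \<in> carrier G \<and> h \<in> carrier G \<and> group.ord G g = group.ord G h}"

definition ESCom :: "('a, 'm) monoid_scheme \<Rightarrow> 'a sgraph" where
  "ESCom G = super_commuting_graph G (Id_on (carrier G))"

definition CSCom :: "('a, 'm) monoid_scheme \<Rightarrow> 'a sgraph" where
  "CSCom G = super_commuting_graph G (conj_rel G)"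

definition OSCom :: "('a, 'm) monoid_scheme \<Rightarrow> 'a sgraph" where
  "OSCom G = super_commuting_graph G (same_order_rel G)"

end

theory Submission
  imports Defs
begin

text \<open>
  Each of the three graphs is a complete graph joined to a disjoint union of complete graphs, and
  every such graph satisfies the Hansen--Vukicevic inequality. Both facts are stated through a
  single condition: the middle vertex of every induced path on three vertices is adjacent to all
  other vertices.

  For the inequality, let \<open>s\<close> be the number of universal vertices, \<open>T\<close> their degree, and let \<open>x v\<close>
  range over the degrees of the other vertices. Once denominators are cleared, the
  difference of the two sides is the sum of a term that is nonnegative by Chebyshev's sum inequality
  and of \<open>s \<Sum>v. (x v - 1) (x v - T)\<^sup>2\<close>; see \<open>degree_polynomial_inequality\<close> and
  \<open>hansen_vukicevic_if_universal_midpoints\<close>.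

  For the graphs, the relations of \<open>V\<^sub>8\<^sub>n\<close> say that \<open>z = b\<^sup>2\<close> is central with \<open>z\<^sup>2 = 1\<close> and that
  \<open>a b a = z b\<close>. Hence \<open>A = \<langle>a, z\<rangle>\<close> is abelian and \<open>V\<^sub>8\<^sub>n\<close> is the union of \<open>A\<close> and \<open>A b\<close>. In a group
  with an abelian subgroup of index at most two, commuting is transitive on noncentral elements
  (\<open>commutation_transitive_if_abelian_index_two\<close>). This is the path condition for equality, and it
  passes to conjugacy because commuting pairs can be conjugated simultaneously
  (\<open>hansen_vukicevic_if_commutation_transitive\<close>).

  For equality of orders, elements outside \<open>A\<close> have square \<open>1\<close> or \<open>z\<close>, which leaves at most one
  element order that does not occur in \<open>A\<close> (\<open>ord_eq_outside_A\<close>). The orders occurring in \<open>A\<close> are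
  pairwise adjacent, so an induced path has to pass from these to the missing order, and its middle
  vertex is adjacent to both kinds (\<open>hansen_vukicevic_OSCom\<close>).
\<close>

section \<open>Graphs in which induced paths have universal midpoints\<close>

definition graph_of :: "'v set \<Rightarrow> ('v \<Rightarrow> 'v \<Rightarrow> bool) \<Rightarrow> 'v sgraph" where
  "graph_of V R =
     \<lparr>vertices = V, edges = {{u, v} | u v. u \<in> V \<and> v \<in> V \<and> u \<noteq> v \<and> R u v}\<rparr>"

definition arcs :: "'v set \<Rightarrow> ('v \<Rightarrow> 'v \<Rightarrow> bool) \<Rightarrow> ('v \<times> 'v) set" where
  "arcs V R = (SIGMA u:V. {v \<in> V. v \<noteq> u \<and> R u v})"

text \<open>
  An edge is the image of exactly two arcs, one in each direction. Reading the edge sums as sums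
  over arcs lets them be evaluated one vertex at a time.
\<close>
lemma sum_edges_eq_sum_arcs:
  fixes f :: "'v set \<Rightarrow> real"
  assumes "finite V" and sym: "\<And>u v. u \<in> V \<Longrightarrow> v \<in> V \<Longrightarrow> R u v \<Longrightarrow> R v u"
  shows "2 * (\<Sum>e\<in>edges (graph_of V R). f e) = (\<Sum>u\<in>V. \<Sum>v\<in>{v \<in> V. v \<noteq> u \<and> R u v}. f {u, v})"
proof -
  let ?e = "\<lambda>(u, v). {u, v}"
  have fin: "finite (arcs V R)"
    using \<open>finite V\<close> by (auto simp: arcs_def)
  have edges_image: "edges (graph_of V R) = ?e ` arcs V R"
  proof (intro equalityI subsetI)
    fix e assume "e \<in> edges (graph_of V R)"
    then obtain u v where "e = {u,v}" "(u,v) \<in> arcs V R"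
      by (auto simp: graph_of_def arcs_def)
    then show "e \<in> (\<lambda>(u, v). {u, v}) ` arcs V R"
      by (intro image_eqI[of _ _ "(u,v)"]) simp_all
  next
    fix e assume "e \<in> (\<lambda>(u, v). {u, v}) ` arcs V R"
    then show "e \<in> edges (graph_of V R)"
      by (auto simp: graph_of_def arcs_def)
  qed
  have fibre: "(\<Sum>p\<in>{p \<in> arcs V R. ?e p = e}. f (?e p)) = 2 * f e"
    if "e \<in> edges (graph_of V R)" for e
  proof -
    obtain u v where uv: "u \<in> V" "v \<in> V" "u \<noteq> v" "R u v" "e = {u, v}"
      using \<open>e \<in> edges (graph_of V R)\<close> by (auto simp: graph_of_def)
    have "{p \<in> arcs V R. ?e p = e} = {(u, v), (v, u)}"
      using uv(1-4) sym[OF uv(1,2,4)] unfolding uv(5) arcs_def by (auto simp: doubleton_eq_iff)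
    then show ?thesis
      using uv by (simp add: insert_commute)
  qed
  have "(\<Sum>u\<in>V. \<Sum>v\<in>{v \<in> V. v \<noteq> u \<and> R u v}. f {u, v}) = (\<Sum>p\<in>arcs V R. f (?e p))"
    using \<open>finite V\<close> by (simp add: arcs_def sum.Sigma case_prod_beta)
  also have "\<dots> = (\<Sum>e\<in>?e ` arcs V R. \<Sum>p\<in>{p \<in> arcs V R. ?e p = e}. f (?e p))"
    by (rule sum.image_gen[OF fin])
  also have "\<dots> = (\<Sum>e\<in>edges (graph_of V R). 2 * f e)"
    unfolding edges_image[symmetric] by (rule sum.cong[OF HOL.refl fibre])
  finally show ?thesis
    by (simp add: sum_distrib_left)
qed

lemma degree_graph_of:
  assumes sym: "\<And>u v. u \<in> V \<Longrightarrow> v \<in> V \<Longrightarrow> R u v \<Longrightarrow> R v u" and "u \<in> V"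
  shows "degree (graph_of V R) u = card {v \<in> V. v \<noteq> u \<and> R u v}"
proof -
  have "{e \<in> edges (graph_of V R). u \<in> e} = (\<lambda>v. {u, v}) ` {v \<in> V. v \<noteq> u \<and> R u v}"
    using sym \<open>u \<in> V\<close> by (auto simp: graph_of_def image_iff insert_commute)
  moreover have "inj_on (\<lambda>v. {u, v}) {v \<in> V. v \<noteq> u \<and> R u v}"
    by (auto simp: inj_on_def doubleton_eq_iff)
  ultimately show ?thesis
    by (simp add: degree_def card_image)
qed

text \<open>
  Chebyshev's sum inequality for the similarly ordered families \<open>x\<close> and \<open>x\<^sup>2\<close>: twice the difference
  of the two sides is the sum of \<open>(x u - x v) ((x u)\<^sup>2 - (x v)\<^sup>2)\<close> over all pairs.
\<close>
lemma sum_mult_sum_squares_le: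
  fixes x :: "'v \<Rightarrow> real"
  assumes "\<And>v. v \<in> A \<Longrightarrow> 0 \<le> x v"
  shows "(\<Sum>v\<in>A. x v) * (\<Sum>v\<in>A. (x v)\<^sup>2) \<le> real (card A) * (\<Sum>v\<in>A. x v ^ 3)"
proof -
  have "0 \<le> (\<Sum>u\<in>A. \<Sum>v\<in>A. (x u + x v) * (x u - x v)\<^sup>2)"
    using assms by (intro sum_nonneg mult_nonneg_nonneg) auto
  also have "\<dots> = (\<Sum>u\<in>A. \<Sum>v\<in>A. x u ^ 3 + x v ^ 3 - x u * (x v)\<^sup>2 - (x u)\<^sup>2 * x v)"
    by (intro sum.cong) (simp_all add: power2_eq_square power3_eq_cube algebra_simps)
  also have "\<dots> = 2 * (real (card A) * (\<Sum>v\<in>A. x v ^ 3) - (\<Sum>v\<in>A. x v) * (\<Sum>v\<in>A. (x v)\<^sup>2))"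
  proof -
    have x_u: "(\<Sum>u\<in>A. \<Sum>v\<in>A. x u ^ 3) = real (card A) * (\<Sum>v\<in>A. x v ^ 3)"
      by (simp add: sum_distrib_left)
    have x_v: "(\<Sum>u\<in>A. \<Sum>v\<in>A. x v ^ 3) = real (card A) * (\<Sum>v\<in>A. x v ^ 3)"
      by simp
    have "c + c - p * q - q * p = 2 * (c - p * q)" for c p q :: real
      by simp
    then show ?thesis
      unfolding sum.distrib sum_subtractf x_u x_v sum_product[symmetric] .
  qed
  finally show ?thesis
    by simp
qed

text \<open>
  The Hansen--Vukicevic inequality with denominators cleared, for a graph with \<open>s\<close> universal
  vertices (of degree \<open>T\<close>) and a set \<open>A\<close> of other vertices with degrees \<open>x v\<close>, which have
  \<open>s\<close> universal neighbours and \<open>x v - s\<close> further ones of the same degree. Writing \<open>\<mu>k\<close> for the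
  \<open>k\<close>-th power sum of the \<open>x v\<close> and \<open>r\<close> for the size of \<open>A\<close>, the difference of the two sides is
  \<open>(r \<mu>3 - \<mu>1 \<mu>2) + s \<Sum>v. (x v - 1) (x v - T)\<^sup>2\<close>. Both summands are nonnegative, the first by
  Chebyshev and the second because a vertex with a universal neighbour has positive degree.
\<close>
lemma degree_polynomial_inequality:
  fixes x :: "'v \<Rightarrow> real" and s T :: real
  assumes "0 \<le> s" and T: "T = s + real (card A) - 1"
    and nonneg: "\<And>v. v \<in> A \<Longrightarrow> 0 \<le> x v"
    and ge_one: "\<And>v. v \<in> A \<Longrightarrow> s \<noteq> 0 \<Longrightarrow> 1 \<le> x v"
  shows "(s * T + (\<Sum>v\<in>A. x v)) * (s * T\<^sup>2 + (\<Sum>v\<in>A. (x v)\<^sup>2)) \<le>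
    (s + real (card A)) *
      (s * (T * ((s - 1) * T + (\<Sum>v\<in>A. x v))) + (\<Sum>v\<in>A. x v * (s * T + (x v - s) * x v)))"
proof -
  define r where "r = real (card A)"
  define \<mu>1 where "\<mu>1 = (\<Sum>v\<in>A. x v)"
  define \<mu>2 where "\<mu>2 = (\<Sum>v\<in>A. (x v)\<^sup>2)"
  define \<mu>3 where "\<mu>3 = (\<Sum>v\<in>A. x v ^ 3)"
  have chebyshev: "0 \<le> r * \<mu>3 - \<mu>1 * \<mu>2"
    using sum_mult_sum_squares_le[of A x] nonneg by (simp add: r_def \<mu>1_def \<mu>2_def \<mu>3_def)
  have r: "r = T + 1 - s"
    using T by (simp add: r_def)
  have "(\<Sum>v\<in>A. (x v - 1) * (x v - T)\<^sup>2) =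
      (\<Sum>v\<in>A. x v ^ 3 - (2 * T + 1) * (x v)\<^sup>2 + T * (T + 2) * x v - T\<^sup>2)"
    by (intro sum.cong) (simp_all add: power2_eq_square power3_eq_cube algebra_simps)
  also have "\<dots> = \<mu>3 - (2 * T + 1) * \<mu>2 + T * (T + 2) * \<mu>1 - r * T\<^sup>2"
    by (simp add: sum.distrib sum_subtractf \<mu>1_def \<mu>2_def \<mu>3_def r_def flip: sum_distrib_left)
  finally have expand: "(\<Sum>v\<in>A. (x v - 1) * (x v - T)\<^sup>2) =
      \<mu>3 - (2 * T + 1) * \<mu>2 + T * (T + 2) * \<mu>1 - r * T\<^sup>2" .
  have "0 \<le> s * (\<Sum>v\<in>A. (x v - 1) * (x v - T)\<^sup>2)"
  proof (cases "s = 0")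
    case False
    then show ?thesis
      using \<open>0 \<le> s\<close> ge_one by (intro mult_nonneg_nonneg sum_nonneg) auto
  qed simp
  with chebyshev have "0 \<le> (r * \<mu>3 - \<mu>1 * \<mu>2) +
      s * (\<mu>3 - (2 * T + 1) * \<mu>2 + T * (T + 2) * \<mu>1 - r * T\<^sup>2)"
    unfolding expand by linarith
  also have "\<dots> = (s + r) * (s * (T * ((s - 1) * T + \<mu>1)) + (s * T * \<mu>1 + \<mu>3 - s * \<mu>2))
      - (s * T + \<mu>1) * (s * T\<^sup>2 + \<mu>2)"
    unfolding r by (simp add: power2_eq_square algebra_simps)
  finally have "(s * T + \<mu>1) * (s * T\<^sup>2 + \<mu>2) \<le>
      (s + r) * (s * (T * ((s - 1) * T + \<mu>1)) + (s * T * \<mu>1 + \<mu>3 - s * \<mu>2))"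
    by simp
  also have "s * T * \<mu>1 + \<mu>3 - s * \<mu>2 = (\<Sum>v\<in>A. s * T * x v + x v ^ 3 - s * (x v)\<^sup>2)"
    by (simp add: sum.distrib sum_subtractf \<mu>1_def \<mu>2_def \<mu>3_def flip: sum_distrib_left)
  also have "\<dots> = (\<Sum>v\<in>A. x v * (s * T + (x v - s) * x v))"
    by (intro sum.cong) (simp_all add: power2_eq_square power3_eq_cube algebra_simps)
  finally show ?thesis
    by (simp add: \<mu>1_def \<mu>2_def r_def)
qed

text \<open>
  If the middle vertex of every induced path on three vertices is universal, then adjacency is
  transitive among the vertices that are not universal. So the graph is a complete graph joined to a
  disjoint union of complete graphs, neighbours that are not universal have equal degrees, and
  the polynomial inequality above applies.
\<close>
lemma hansen_vukicevic_if_universal_midpoints: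
  fixes V :: "'v set" and R :: "'v \<Rightarrow> 'v \<Rightarrow> bool"
  assumes fin: "finite V"
    and refl: "\<And>u. u \<in> V \<Longrightarrow> R u u"
    and sym: "\<And>u v. u \<in> V \<Longrightarrow> v \<in> V \<Longrightarrow> R u v \<Longrightarrow> R v u"
    and midpoint: "\<And>u v w x. u \<in> V \<Longrightarrow> v \<in> V \<Longrightarrow> w \<in> V \<Longrightarrow> x \<in> V \<Longrightarrow>
      R u v \<Longrightarrow> R v w \<Longrightarrow> \<not> R u w \<Longrightarrow> R v x"
  shows "hansen_vukicevic (graph_of V R)"
proof -
  define \<Gamma> where "\<Gamma> = graph_of V R"
  define S where "S = {v \<in> V. \<forall>u\<in>V. R v u}"
  define A where "A = V - S"
  define nbrs where "nbrs u = {v \<in> V. v \<noteq> u \<and> R u v}" for u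
  define x where "x v = real (degree \<Gamma> v)" for v
  define s where "s = real (card S)"
  define T where "T = s + real (card A) - 1"
  have S: "S \<subseteq> V" and finS: "finite S" and finA: "finite A"
    using fin by (auto simp: S_def A_def)
  have sum_V: "(\<Sum>v\<in>V. f v) = (\<Sum>v\<in>S. f v) + (\<Sum>v\<in>A. f v)" for f :: "'v \<Rightarrow> real"
    using sum.subset_diff[OF S fin, of f] by (simp add: A_def)
  have card_V: "real (card V) = s + real (card A)"
    using sum_V[of "\<lambda>_. 1"] by (simp add: s_def)
  have degree: "x v = real (card (nbrs v))" if "v \<in> V" for v
    using degree_graph_of[of V R v] sym that by (auto simp: x_def \<Gamma>_def nbrs_def)
  have nbrs_S: "nbrs v = V - {v}" if "v \<in> S" for v
    using that by (auto simp: S_def nbrs_def)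
  have x_S: "x v = T" if "v \<in> S" for v
  proof -
    have "card V \<ge> 1"
      using that S fin by (auto simp: Suc_le_eq card_gt_0_iff)
    moreover have "v \<in> V"
      using that S by auto
    ultimately show ?thesis
      using degree[of v] nbrs_S[OF that] card_V fin by (simp add: T_def)
  qed
  have S_nbrs: "S \<subseteq> nbrs v" if "v \<in> A" for v
    using that sym by (auto simp: A_def S_def nbrs_def)
  have x_A_ge: "s \<le> x v" if "v \<in> A" for v
    using that degree[of v] card_mono[OF _ S_nbrs[OF that]] fin
    by (auto simp: A_def s_def nbrs_def)
  \<comment> \<open>adjacent vertices outside \<open>S\<close> have the same closed neighbourhood, as a vertex in the
    difference would make one of them the middle of an induced path\<close>
  have x_nbr: "x u = x v" if "v \<in> A" "u \<in> nbrs v" "u \<notin> S" for u v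
  proof -
    have V: "u \<in> V" "v \<in> V" and "R v u" "R u v" "u \<noteq> v"
      using that sym by (auto simp: A_def nbrs_def)
    have "R v w \<longleftrightarrow> R u w" if "w \<in> V" for w
    proof
      assume "R v w"
      show "R u w"
      proof (rule ccontr)
        assume "\<not> R u w"
        then have "\<forall>y\<in>V. R v y"
          using midpoint[OF V that _ \<open>R u v\<close> \<open>R v w\<close>] by blast
        then show False
          using \<open>v \<in> A\<close> by (auto simp: A_def S_def)
      qed
    next
      assume "R u w"
      show "R v w"
      proof (rule ccontr)
        assume "\<not> R v w"
        then have "\<forall>y\<in>V. R u y"
          using midpoint[OF V(2,1) that _ \<open>R v u\<close> \<open>R u w\<close>] by blast
        then show False
          using \<open>u \<notin> S\<close> V by (auto simp: S_def)
      qed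
    qed
    then have "insert v (nbrs v) = insert u (nbrs u)"
      using V refl by (auto simp: nbrs_def)
    then have "card (insert v (nbrs v)) = card (insert u (nbrs u))"
      by simp
    then have "card (nbrs v) = card (nbrs u)"
      using fin by (simp add: nbrs_def)
    then show ?thesis
      using degree V by simp
  qed
  have nbr_sum_S: "(\<Sum>u\<in>nbrs v. x u) = (s - 1) * T + (\<Sum>u\<in>A. x u)" if "v \<in> S" for v
  proof -
    have "(\<Sum>u\<in>nbrs v. x u) = (\<Sum>u\<in>V. x u) - x v"
      using that S fin by (auto simp: nbrs_S sum_diff1)
    also have "(\<Sum>u\<in>V. x u) = s * T + (\<Sum>u\<in>A. x u)"
      by (simp add: sum_V x_S s_def)
    finally show ?thesis
      using x_S[OF that] by (simp add: algebra_simps)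
  qed
  have nbr_sum_A: "(\<Sum>u\<in>nbrs v. x u) = s * T + (x v - s) * x v" if "v \<in> A" for v
  proof -
    have finN: "finite (nbrs v)" and "v \<in> V"
      using fin that by (auto simp: nbrs_def A_def)
    have "(\<Sum>u\<in>nbrs v. x u) = (\<Sum>u\<in>nbrs v - S. x u) + (\<Sum>u\<in>S. x u)"
      by (rule sum.subset_diff[OF S_nbrs[OF that] finN])
    also have "(\<Sum>u\<in>nbrs v - S. x u) = (\<Sum>u\<in>nbrs v - S. x v)"
      using x_nbr[OF that] by (intro sum.cong) auto
    also have "\<dots> = (x v - s) * x v"
      using card_Diff_subset[OF finS S_nbrs[OF that]] card_mono[OF finN S_nbrs[OF that]]
        degree[OF \<open>v \<in> V\<close>] by (simp add: s_def of_nat_diff)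
    also have "(\<Sum>u\<in>S. x u) = s * T"
      by (simp add: x_S s_def)
    finally show ?thesis
      by simp
  qed

  have twice_edges: "2 * real (card (edges \<Gamma>)) = s * T + (\<Sum>v\<in>A. x v)"
  proof -
    have "2 * real (card (edges \<Gamma>)) = (\<Sum>u\<in>V. \<Sum>v\<in>nbrs u. 1)"
      using sum_edges_eq_sum_arcs[OF fin sym, where f = "\<lambda>_. 1"] by (simp add: \<Gamma>_def nbrs_def)
    also have "\<dots> = (\<Sum>u\<in>V. x u)"
      by (intro sum.cong) (simp_all add: degree)
    finally show ?thesis
      by (simp add: sum_V x_S s_def)
  qed
  have zagreb1: "real (zagreb1 \<Gamma>) = s * T\<^sup>2 + (\<Sum>v\<in>A. (x v)\<^sup>2)"
  proof -
    have "real (zagreb1 \<Gamma>) = (\<Sum>v\<in>V. (x v)\<^sup>2)"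
      by (simp add: zagreb1_def \<Gamma>_def graph_of_def x_def)
    then show ?thesis
      by (simp add: sum_V x_S s_def)
  qed
  have twice_zagreb2: "2 * real (zagreb2 \<Gamma>) =
      s * (T * ((s - 1) * T + (\<Sum>v\<in>A. x v))) + (\<Sum>v\<in>A. x v * (s * T + (x v - s) * x v))"
  proof -
    have "2 * real (zagreb2 \<Gamma>) = 2 * (\<Sum>e\<in>edges \<Gamma>. \<Prod>v\<in>e. x v)"
      by (simp add: zagreb2_def x_def)
    also have "\<dots> = (\<Sum>u\<in>V. \<Sum>v\<in>nbrs u. \<Prod>w\<in>{u, v}. x w)"
      unfolding \<Gamma>_def nbrs_def by (rule sum_edges_eq_sum_arcs[OF fin sym])
    also have "\<dots> = (\<Sum>u\<in>V. x u * (\<Sum>v\<in>nbrs u. x v))"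
      unfolding sum_distrib_left by (intro sum.cong) (auto simp: nbrs_def)
    also have "\<dots> = s * (T * ((s - 1) * T + (\<Sum>v\<in>A. x v))) +
        (\<Sum>v\<in>A. x v * (s * T + (x v - s) * x v))"
      by (simp add: sum_V x_S nbr_sum_S nbr_sum_A s_def)
    finally show ?thesis .
  qed

  have ineq: "2 * real (card (edges \<Gamma>)) * real (zagreb1 \<Gamma>) \<le> real (card V) * (2 * real (zagreb2 \<Gamma>))"
    unfolding twice_edges zagreb1 twice_zagreb2 card_V
  proof (rule degree_polynomial_inequality)
    show "1 \<le> x v" if "v \<in> A" "s \<noteq> 0" for v
    proof -
      have "1 \<le> s"
        using \<open>s \<noteq> 0\<close> by (simp add: s_def Suc_le_eq)
      then show ?thesis
        using x_A_ge[OF \<open>v \<in> A\<close>] by linarith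
    qed
  qed (simp_all add: s_def T_def x_def)
  show ?thesis
  proof (cases "card (edges \<Gamma>) = 0 \<or> card V = 0")
    case True
    \<comment> \<open>without edges \<open>M\<^sub>2 / |e|\<close> is \<open>0 / 0 = 0\<close>, so the other side has to vanish as well\<close>
    have "zagreb1 \<Gamma> = 0" if "card (edges \<Gamma>) = 0"
    proof -
      have "finite (edges \<Gamma>)"
        using fin by (auto intro: finite_subset[of _ "Pow V"] simp: \<Gamma>_def graph_of_def)
      then show ?thesis
        using that by (simp add: zagreb1_def degree_def)
    qed
    with True show ?thesis
      by (auto simp: hansen_vukicevic_def \<Gamma>_def graph_of_def)
  next
    case False
    then have "0 < real (card (edges \<Gamma>))" "0 < real (card V)"
      by auto
    moreover have "card (vertices \<Gamma>) = card V"
      by (simp add: \<Gamma>_def graph_of_def)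
    ultimately have "hansen_vukicevic \<Gamma>"
      using ineq by (simp add: hansen_vukicevic_def field_simps)
    then show ?thesis
      by (simp add: \<Gamma>_def)
  qed
qed


section \<open>Super commuting graphs\<close>

definition class_commute :: "('a, 'm) monoid_scheme \<Rightarrow> 'a rel \<Rightarrow> 'a \<Rightarrow> 'a \<Rightarrow> bool" where
  "class_commute G B g h \<longleftrightarrow>
     (\<exists>g' h'. (g, g') \<in> B \<and> (h, h') \<in> B \<and> g' \<otimes>\<^bsub>G\<^esub> h' = h' \<otimes>\<^bsub>G\<^esub> g')"

lemma class_commute_sym: "class_commute G B g h \<Longrightarrow> class_commute G B h g"
  unfolding class_commute_def by (elim exE conjE) (intro exI conjI, assumption, assumption, rule HOL.sym)

lemma class_commute_if_related:
  assumes "equiv (carrier G) B" and "(g, h) \<in> B"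
  shows "class_commute G B g h"
proof -
  have "(h, h) \<in> B"
    using assms by (meson equiv_def symD transD)
  with assms(2) show ?thesis
    unfolding class_commute_def by blast
qed

text \<open>
  The first alternative in the adjacency is absorbed by the second, because an element of a common
  class commutes with itself.
\<close>
lemma super_commuting_graph_eq_graph_of:
  assumes B: "equiv (carrier G) B"
  shows "super_commuting_graph G B = graph_of (carrier G) (class_commute G B)"
proof -
  have adj: "B `` {g} = B `` {h} \<or> (\<exists>g'\<in>B `` {g}. \<exists>h'\<in>B `` {h}. g' \<otimes>\<^bsub>G\<^esub> h' = h' \<otimes>\<^bsub>G\<^esub> g') \<longleftrightarrow>
      class_commute G B g h" (is "?L \<or> ?M \<longleftrightarrow> _") if "h \<in> carrier G" for g h
  proof -
    have "?M \<longleftrightarrow> class_commute G B g h"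
      unfolding class_commute_def by blast
    moreover have "class_commute G B g h" if ?L
      using class_commute_if_related[OF B] eq_equiv_class[OF that B \<open>h \<in> carrier G\<close>] .
    ultimately show ?thesis
      by blast
  qed
  show ?thesis
    unfolding super_commuting_graph_def graph_of_def
    by (intro arg_cong2[where f = "\<lambda>V E. \<lparr>vertices = V, edges = E\<rparr>"] HOL.refl
        Collect_cong ex_cong1 conj_cong adj)
qed

lemma hansen_vukicevic_super_commuting_graph:
  assumes "finite (carrier G)" and B: "equiv (carrier G) B"
    and "\<And>u v w x. u \<in> carrier G \<Longrightarrow> v \<in> carrier G \<Longrightarrow> w \<in> carrier G \<Longrightarrow> x \<in> carrier G \<Longrightarrow>
      class_commute G B u v \<Longrightarrow> class_commute G B v w \<Longrightarrow> \<not> class_commute G B u w \<Longrightarrow>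
      class_commute G B v x"
  shows "hansen_vukicevic (super_commuting_graph G B)"
  unfolding super_commuting_graph_eq_graph_of[OF B]
proof (rule hansen_vukicevic_if_universal_midpoints[OF assms(1)])
  show "class_commute G B u u" if "u \<in> carrier G" for u
    using that class_commute_if_related[OF B] B by (meson equiv_def refl_onD)
  show "class_commute G B v u" if "class_commute G B u v" for u v
    using that by (rule class_commute_sym)
qed (rule assms(3))

text \<open>
  Equivalently, commuting is a transitive relation on the noncentral elements, that is, centralizers
  of noncentral elements are abelian.
\<close>
definition commutation_transitive :: "('a, 'm) monoid_scheme \<Rightarrow> bool" where
  "commutation_transitive G \<longleftrightarrow>
     (\<forall>u\<in>carrier G. \<forall>v\<in>carrier G. \<forall>w\<in>carrier G.
        u \<otimes>\<^bsub>G\<^esub> v = v \<otimes>\<^bsub>G\<^esub> u \<longrightarrow> v \<otimes>\<^bsub>G\<^esub> w = w \<otimes>\<^bsub>G\<^esub> v \<longrightarrow> u \<otimes>\<^bsub>G\<^esub> w \<noteq> w \<otimes>\<^bsub>G\<^esub> u \<longrightarrow>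
        (\<forall>x\<in>carrier G. v \<otimes>\<^bsub>G\<^esub> x = x \<otimes>\<^bsub>G\<^esub> v))"

text \<open>
  The lifting hypothesis says that when the second of two commuting elements is replaced by a
  related one, the first can be adjusted within its class; equality and conjugacy both have this
  property. It turns a path of length two between classes into two commuting pairs that share
  their middle element, and then transitivity of commuting applies.
\<close>
lemma hansen_vukicevic_if_commutation_transitive:
  assumes fin: "finite (carrier G)" and B: "equiv (carrier G) B"
    and ct: "commutation_transitive G"
    and lift: "\<And>u v v'. u \<in> carrier G \<Longrightarrow> u \<otimes>\<^bsub>G\<^esub> v = v \<otimes>\<^bsub>G\<^esub> u \<Longrightarrow> (v, v') \<in> B \<Longrightarrow>
      \<exists>u'. (u, u') \<in> B \<and> u' \<otimes>\<^bsub>G\<^esub> v' = v' \<otimes>\<^bsub>G\<^esub> u'"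
  shows "hansen_vukicevic (super_commuting_graph G B)"
proof (rule hansen_vukicevic_super_commuting_graph[OF fin B])
  have sub: "B \<subseteq> carrier G \<times> carrier G" and "sym B" "trans B" and "refl_on (carrier G) B"
    using B by (auto simp: equiv_def)
  fix u v w x
  assume x: "x \<in> carrier G" and "class_commute G B u v" "class_commute G B v w"
    and not_uw: "\<not> class_commute G B u w"
  then obtain u1 v1 v2 w2 where uv: "(u, u1) \<in> B" "(v, v1) \<in> B" "u1 \<otimes>\<^bsub>G\<^esub> v1 = v1 \<otimes>\<^bsub>G\<^esub> u1"
    and vw: "(v, v2) \<in> B" "(w, w2) \<in> B" "v2 \<otimes>\<^bsub>G\<^esub> w2 = w2 \<otimes>\<^bsub>G\<^esub> v2"
    unfolding class_commute_def by metis
  have "(v1, v2) \<in> B"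
    using uv vw \<open>sym B\<close> \<open>trans B\<close> by (meson symD transD)
  then obtain u2 where u2: "(u1, u2) \<in> B" "u2 \<otimes>\<^bsub>G\<^esub> v2 = v2 \<otimes>\<^bsub>G\<^esub> u2"
    using lift[of u1 v1 v2] uv sub by blast
  have "(u, u2) \<in> B"
    using uv u2 \<open>trans B\<close> by (meson transD)
  then have "u2 \<otimes>\<^bsub>G\<^esub> w2 \<noteq> w2 \<otimes>\<^bsub>G\<^esub> u2"
    using not_uw vw unfolding class_commute_def by metis
  then have "v2 \<otimes>\<^bsub>G\<^esub> x = x \<otimes>\<^bsub>G\<^esub> v2"
    using ct u2 vw x sub unfolding commutation_transitive_def by blast
  moreover have "(x, x) \<in> B"
    using \<open>refl_on (carrier G) B\<close> x by (simp add: refl_on_def)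
  ultimately show "class_commute G B v x"
    using vw unfolding class_commute_def by metis
qed

lemma (in group) equiv_conj_rel: "equiv (carrier G) (conj_rel G)"
proof (rule equivI)
  show "conj_rel G \<subseteq> carrier G \<times> carrier G"
    by (auto simp: conj_rel_def)
  show "refl_on (carrier G) (conj_rel G)"
  proof (rule refl_onI)
    fix g assume "g \<in> carrier G"
    moreover have "g = \<one> \<otimes> g \<otimes> inv \<one>"
      using calculation by simp
    ultimately show "(g, g) \<in> conj_rel G"
      unfolding conj_rel_def by blast
  qed
  show "sym (conj_rel G)"
  proof (rule symI)
    fix g h assume "(g, h) \<in> conj_rel G"
    then obtain x where x: "x \<in> carrier G" "g \<in> carrier G" "h = x \<otimes> g \<otimes> inv x"
      by (auto simp: conj_rel_def)
    then have "g = inv x \<otimes> h \<otimes> inv (inv x)"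
      by (simp add: m_assoc inv_solve_left)
    moreover have "inv x \<in> carrier G" "h \<in> carrier G"
      using x by simp_all
    ultimately show "(h, g) \<in> conj_rel G"
      using \<open>g \<in> carrier G\<close> unfolding conj_rel_def by blast
  qed
  show "trans (conj_rel G)"
  proof (rule transI)
    fix g h k assume "(g, h) \<in> conj_rel G" "(h, k) \<in> conj_rel G"
    then obtain x y where xy: "x \<in> carrier G" "y \<in> carrier G" "g \<in> carrier G"
      "h = x \<otimes> g \<otimes> inv x" "k = y \<otimes> h \<otimes> inv y"
      by (auto simp: conj_rel_def)
    then have "k = (y \<otimes> x) \<otimes> g \<otimes> inv (y \<otimes> x)"
      by (simp add: m_assoc inv_mult_group)
    moreover have "y \<otimes> x \<in> carrier G" "k \<in> carrier G"
      using xy by simp_all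
    ultimately show "(g, k) \<in> conj_rel G"
      using \<open>g \<in> carrier G\<close> unfolding conj_rel_def by blast
  qed
qed

lemma (in group) hansen_vukicevic_ESCom:
  assumes "finite (carrier G)" and "commutation_transitive G"
  shows "hansen_vukicevic (ESCom G)"
  unfolding ESCom_def
proof (rule hansen_vukicevic_if_commutation_transitive[OF assms(1) _ assms(2)])
  show "equiv (carrier G) (Id_on (carrier G))"
    by (intro equivI Id_on_subset_Times refl_on_Id_on sym_Id_on trans_Id_on)
qed blast

lemma (in group) hansen_vukicevic_CSCom:
  assumes "finite (carrier G)" and "commutation_transitive G"
  shows "hansen_vukicevic (CSCom G)"
  unfolding CSCom_def
proof (rule hansen_vukicevic_if_commutation_transitive[OF assms(1) equiv_conj_rel assms(2)])
  fix u v v' assume u: "u \<in> carrier G" "u \<otimes> v = v \<otimes> u" and "(v, v') \<in> conj_rel G"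
  then obtain x where x: "x \<in> carrier G" "v \<in> carrier G" "v' = x \<otimes> v \<otimes> inv x"
    by (auto simp: conj_rel_def)
  have conj_mult: "(x \<otimes> p \<otimes> inv x) \<otimes> (x \<otimes> q \<otimes> inv x) = x \<otimes> (p \<otimes> q) \<otimes> inv x"
    if "p \<in> carrier G" "q \<in> carrier G" for p q
  proof -
    have "inv x \<otimes> (x \<otimes> (q \<otimes> inv x)) = q \<otimes> inv x"
      using that x by (simp flip: m_assoc)
    then show ?thesis
      using that x by (simp add: m_assoc)
  qed
  have "(u, x \<otimes> u \<otimes> inv x) \<in> conj_rel G"
    using u x by (auto simp: conj_rel_def)
  moreover have "(x \<otimes> u \<otimes> inv x) \<otimes> v' = v' \<otimes> (x \<otimes> u \<otimes> inv x)"
    using u x by (simp add: conj_mult)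
  ultimately show "\<exists>u'. (u, u') \<in> conj_rel G \<and> u' \<otimes> v' = v' \<otimes> u'"
    by blast
qed

text \<open>
  The index hypothesis says that \<open>A\<close> has at most two cosets. The centralizer of a noncentral
  element of \<open>A\<close> is \<open>A\<close>. An element \<open>v\<close> outside \<open>A\<close> commutes with \<open>c v\<close>, where \<open>c \<in> A\<close>, only if \<open>c\<close>
  commutes with \<open>v\<close>, hence is central; so its centralizer is generated by \<open>v\<close> and the centre.
\<close>
lemma (in group) commutation_transitive_if_abelian_index_two:
  assumes A: "subgroup A G"
    and comm: "\<And>c d. c \<in> A \<Longrightarrow> d \<in> A \<Longrightarrow> c \<otimes> d = d \<otimes> c"
    and index: "\<And>x y. x \<in> carrier G - A \<Longrightarrow> y \<in> carrier G - A \<Longrightarrow> x \<otimes> inv y \<in> A"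
  shows "commutation_transitive G"
proof -
  have A_sub: "A \<subseteq> carrier G"
    by (rule subgroup.subset[OF A])
  have decomp: "\<exists>c\<in>A. x = c \<otimes> y"
    if "x \<in> carrier G - A" "y \<in> carrier G - A" for x y
    using that index by (intro bexI[of _ "x \<otimes> inv y"]) (auto simp: m_assoc)
  have mult_comm: "(c \<otimes> v) \<otimes> y = y \<otimes> (c \<otimes> v)"
    if "c \<in> carrier G" "v \<in> carrier G" "y \<in> carrier G"
      "c \<otimes> y = y \<otimes> c" "v \<otimes> y = y \<otimes> v" for c v y
    using that by (metis m_assoc)
  have cancel_comm: "c \<otimes> v = v \<otimes> c"
    if "c \<in> carrier G" "v \<in> carrier G" "(c \<otimes> v) \<otimes> v = v \<otimes> (c \<otimes> v)" for c v
    using that by (metis m_assoc m_closed right_cancel)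
  \<comment> \<open>\<open>A\<close> and any element \<open>y\<close> outside it generate the group, so commuting with both is being central\<close>
  have central: "c \<otimes> x = x \<otimes> c"
    if "c \<in> A" "y \<in> carrier G - A" "c \<otimes> y = y \<otimes> c" "x \<in> carrier G" for c x y
  proof (cases "x \<in> A")
    case False
    then obtain d where "d \<in> A" "x = d \<otimes> y"
      using decomp \<open>x \<in> carrier G\<close> \<open>y \<in> carrier G - A\<close> by blast
    then show ?thesis
      using mult_comm[of d y c] comm[of d c] subsetD[OF A_sub] that by simp
  qed (use comm that in blast)
  have central': "c \<otimes> x = x \<otimes> c"
    if "c \<in> A" "y \<in> carrier G - A" "y \<otimes> c = c \<otimes> y" "x \<in> carrier G" for c x y
    using central[OF that(1,2) that(3)[symmetric] that(4)] .
  show ?thesis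
    unfolding commutation_transitive_def
  proof (intro ballI impI)
    fix u v w x
    assume carr: "u \<in> carrier G" "v \<in> carrier G" "w \<in> carrier G" "x \<in> carrier G"
      and uv: "u \<otimes> v = v \<otimes> u" and vw: "v \<otimes> w = w \<otimes> v" and uw: "u \<otimes> w \<noteq> w \<otimes> u"
    show "v \<otimes> x = x \<otimes> v"
    proof (cases "v \<in> A")
      case True
      then have "u \<notin> A \<or> w \<notin> A"
        using comm uw by blast
      then show ?thesis
        using central[OF True _ vw] central'[OF True _ uv] carr by blast
    next
      case False
      \<comment> \<open>\<open>u\<close> and \<open>w\<close> commute with \<open>v\<close>, so if one of them were in \<open>A\<close>, it would be central\<close>
      have "u \<notin> A"
        using central[of u v w] uv uw carr False by blast
      have "w \<notin> A"
        using central'[of w v u] vw uw carr False by fastforce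
      obtain c where c: "c \<in> A" "u = c \<otimes> v"
        using decomp[of u v] \<open>u \<notin> A\<close> carr False by blast
      have "c \<otimes> v = v \<otimes> c"
        using cancel_comm[of c v] c uv carr A_sub by blast
      then have "c \<otimes> w = w \<otimes> c"
        using central[of c v w] c carr False by blast
      then have "u \<otimes> w = w \<otimes> u"
        using mult_comm[of c v w] c vw carr A_sub by blast
      with uw show ?thesis
        by contradiction
    qed
  qed
qed

lemma (in group) equiv_same_order_rel: "equiv (carrier G) (same_order_rel G)"
  by (intro equivI refl_onI symI transI) (auto simp: same_order_rel_def)

text \<open>
  Any two orders that occur in \<open>A\<close> are realized by commuting elements, and by hypothesis at most
  one order is missing from \<open>A\<close>. So the elements with an order from \<open>A\<close> form a clique, those with
  the missing order form another one, and the two are linked only through classes that are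
  adjacent to everything.
\<close>
lemma (in group) hansen_vukicevic_OSCom:
  assumes fin: "finite (carrier G)"
    and A_sub: "A \<subseteq> carrier G"
    and comm: "\<And>c d. c \<in> A \<Longrightarrow> d \<in> A \<Longrightarrow> c \<otimes> d = d \<otimes> c"
    and one_order: "\<And>x y. x \<in> carrier G \<Longrightarrow> y \<in> carrier G \<Longrightarrow>
      ord x \<notin> ord ` A \<Longrightarrow> ord y \<notin> ord ` A \<Longrightarrow> ord x = ord y"
  shows "hansen_vukicevic (OSCom G)"
  unfolding OSCom_def
proof (rule hansen_vukicevic_super_commuting_graph[OF fin equiv_same_order_rel])
  let ?R = "class_commute G (same_order_rel G)"
  have inside: "?R x y"
    if "x \<in> carrier G" "y \<in> carrier G" "ord x \<in> ord ` A" "ord y \<in> ord ` A" for x y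
  proof -
    obtain c d where "c \<in> A" "d \<in> A" "ord x = ord c" "ord y = ord d"
      using \<open>ord x \<in> ord ` A\<close> \<open>ord y \<in> ord ` A\<close> by blast
    then show ?thesis
      using comm[of c d] A_sub \<open>x \<in> carrier G\<close> \<open>y \<in> carrier G\<close>
      unfolding class_commute_def same_order_rel_def by blast
  qed
  have same: "?R x y \<longleftrightarrow> ?R x' y'"
    if "x \<in> carrier G" "y \<in> carrier G" "x' \<in> carrier G" "y' \<in> carrier G"
      "ord x = ord x'" "ord y = ord y'" for x y x' y'
    using that unfolding class_commute_def same_order_rel_def by auto
  fix u v w x
  assume carr: "u \<in> carrier G" "v \<in> carrier G" "w \<in> carrier G" "x \<in> carrier G"
    and uv: "?R u v" and vw: "?R v w" and uw: "\<not> ?R u w"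
  show "?R v x"
  proof (cases "ord v \<in> ord ` A")
    case False
    then have "?R u w"
    proof (cases "ord u \<in> ord ` A")
      case True
      have "ord w \<notin> ord ` A"
        using inside carr True uw by blast
      then show ?thesis
        using one_order[of v w] same[of u v u w] uv carr False by auto
    next
      case u: False
      then show ?thesis
        using one_order[of v u] same[of v w u w] vw carr False by auto
    qed
    with uw show ?thesis
      by contradiction
  next
    case True
    \<comment> \<open>one of \<open>u\<close> and \<open>w\<close> has the missing order, so \<open>v\<close> is adjacent to all elements of that order\<close>
    obtain y where y: "y \<in> carrier G" "ord y \<notin> ord ` A" "?R v y"
      using inside[of u w] uw uv vw carr class_commute_sym[OF uv] by blast
    show ?thesis
    proof (cases "ord x \<in> ord ` A")
      case False
      then show ?thesis
        using one_order[of x y] same[of v y v x] y carr by auto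
    qed (use inside carr True in blast)
  qed
qed


section \<open>The structure of the groups \<open>V\<^sub>8\<^sub>n\<close>\<close>

locale V8_relations = group G for G :: "('a, 'm) monoid_scheme" (structure) +
  fixes a b :: 'a and n :: nat
  assumes a_closed [simp]: "a \<in> carrier G" and b_closed [simp]: "b \<in> carrier G"
    and n_pos: "0 < n"
    and a_pow: "a [^] (2 * n) = \<one>"
    and b_pow: "b [^] (4 :: nat) = \<one>"
    and b_a: "b \<otimes> a = inv a \<otimes> inv b"
    and inv_b_a: "inv b \<otimes> a = inv a \<otimes> b"
    and generated: "carrier G = generate G {a, b}"
begin

definition z :: 'a where "z = b \<otimes> b"

definition A :: "'a set" where "A = {a [^] i \<otimes> z [^] k | (i :: nat) (k :: nat). True}"

lemma z_closed [simp]: "z \<in> carrier G"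
  by (simp add: z_def)

lemma z_z: "z \<otimes> z = \<one>"
  using b_pow by (simp add: z_def numeral_eq_Suc m_assoc)

lemma inv_b: "inv b = z \<otimes> b"
  using z_z by (intro inv_equality) (simp_all add: z_def m_assoc)

text \<open>
  This form of the relation \<open>b_a\<close> drives the later computations: it moves \<open>b\<close> past powers of \<open>a\<close>
  at the cost of powers of \<open>z\<close>, which will turn out to be central.
\<close>
lemma a_b_a: "a \<otimes> b \<otimes> a = z \<otimes> b"
proof -
  have "a \<otimes> b \<otimes> a = a \<otimes> (inv a \<otimes> inv b)"
    by (simp add: m_assoc b_a)
  then show ?thesis
    by (simp add: inv_b flip: m_assoc)
qed

text \<open>
  Since \<open>b\<close> has inverse \<open>z b\<close>, the relations \<open>b_a\<close> and \<open>inv_b_a\<close> read \<open>a b a = z b\<close> and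
  \<open>a z b a = b\<close>. Multiplying the first by \<open>z\<close> gives
  \<open>z a b a = b\<close>, and comparison with the second shows that \<open>z\<close> and \<open>a\<close> commute.
\<close>
lemma z_a: "z \<otimes> a = a \<otimes> z"
proof -
  have "a \<otimes> z \<otimes> (b \<otimes> a) = a \<otimes> (inv b \<otimes> a)"
    by (simp add: inv_b m_assoc)
  also have "\<dots> = b"
    unfolding inv_b_a by (simp flip: m_assoc)
  also have "\<dots> = z \<otimes> (z \<otimes> b)"
    by (simp add: z_z flip: m_assoc)
  also have "\<dots> = z \<otimes> a \<otimes> (b \<otimes> a)"
    by (simp add: m_assoc flip: a_b_a)
  finally show ?thesis
    by simp
qed

lemma z_b: "z \<otimes> b = b \<otimes> z"
  by (simp add: z_def m_assoc)

lemma z_pow_a_pow: "z [^] (k :: nat) \<otimes> a [^] (i :: nat) = a [^] i \<otimes> z [^] k"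
  using group_commutes_pow[of a z i] group_commutes_pow[of z "a [^] i" k] z_a by simp

lemma z_pow_cases: "z [^] (k :: nat) = \<one> \<or> z [^] k = z"
  by (induction k) (auto simp: z_z)

lemma A_mult:
  "(a [^] (i :: nat) \<otimes> z [^] (k :: nat)) \<otimes> (a [^] (j :: nat) \<otimes> z [^] (l :: nat)) =
    a [^] (i + j) \<otimes> z [^] (k + l)"
proof -
  have "(a [^] i \<otimes> z [^] k) \<otimes> (a [^] j \<otimes> z [^] l) =
      a [^] i \<otimes> (z [^] k \<otimes> a [^] j) \<otimes> z [^] l"
    by (simp add: m_assoc)
  also have "\<dots> = (a [^] i \<otimes> a [^] j) \<otimes> (z [^] k \<otimes> z [^] l)"
    unfolding z_pow_a_pow by (simp add: m_assoc)
  finally show ?thesis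
    by (simp add: nat_pow_mult)
qed

lemma A_comm: "c \<in> A \<Longrightarrow> d \<in> A \<Longrightarrow> c \<otimes> d = d \<otimes> c"
  unfolding A_def by (auto simp: A_mult add.commute)

lemma A_memI [intro]: "a [^] (i :: nat) \<otimes> z [^] (k :: nat) \<in> A"
  unfolding A_def by blast

lemma a_mem_A: "a \<in> A"
  using A_memI[of 1 0] by simp

lemma z_mem_A: "z \<in> A"
  using A_memI[of 0 1] by simp

lemma subgroup_A: "subgroup A G"
proof (rule subgroupI)
  show "A \<subseteq> carrier G"
    by (auto simp: A_def)
  show "A \<noteq> {}"
    using a_mem_A by blast
next
  fix c d assume "c \<in> A" "d \<in> A"
  then obtain i k j l :: nat where "c = a [^] i \<otimes> z [^] k" "d = a [^] j \<otimes> z [^] l"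
    by (auto simp: A_def)
  then show "c \<otimes> d \<in> A"
    by (simp add: A_mult A_memI)
next
  fix c assume "c \<in> A"
  then obtain i k :: nat where c: "c = a [^] i \<otimes> z [^] k"
    by (auto simp: A_def)
  have "(a [^] (i * (2 * n - 1)) \<otimes> z [^] k) \<otimes> c = a [^] (2 * n * i) \<otimes> z [^] (2 * k)"
  proof -
    have "i * (2 * n - 1) + i = 2 * n * i"
      using n_pos by (cases n) (simp_all add: algebra_simps)
    then show ?thesis
      by (simp add: c A_mult mult_2)
  qed
  also have "\<dots> = \<one>"
  proof -
    have "z [^] (2 :: nat) = \<one>"
      using z_z by (simp add: numeral_2_eq_2)
    then show ?thesis
      by (simp add: a_pow flip: nat_pow_pow)
  qed
  finally have "inv c = a [^] (i * (2 * n - 1)) \<otimes> z [^] k"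
    by (intro inv_equality) (simp_all add: c)
  then show "inv c \<in> A"
    by (simp add: A_memI)
qed

lemma A_closed [simp]: "c \<in> A \<Longrightarrow> c \<in> carrier G"
  using subgroup.subset[OF subgroup_A] by blast

text \<open>
  Conjugation by \<open>b\<close> inverts the elements of \<open>A\<close> up to a power of \<open>z\<close>. In this form the
  statement gives both the normality of \<open>A\<close> and the squares of the elements outside \<open>A\<close>.
\<close>
lemma b_twists_A:
  assumes "c \<in> A"
  obtains j :: nat where "c \<otimes> b \<otimes> c = z [^] j \<otimes> b"
proof -
  obtain i k :: nat where c: "c = a [^] i \<otimes> z [^] k"
    using assms by (auto simp: A_def)
  have z_comm: "z [^] k \<otimes> x = x \<otimes> z [^] k" if "x \<in> carrier G" "z \<otimes> x = x \<otimes> z" for k :: nat and x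
    using group_commutes_pow[of z x k] that by simp
  have a_pow_b: "a [^] i \<otimes> b \<otimes> a [^] i = z [^] i \<otimes> b" for i :: nat
  proof (induction i)
    case (Suc i)
    have "a [^] Suc i \<otimes> b \<otimes> a [^] Suc i = a [^] i \<otimes> (a \<otimes> b \<otimes> a) \<otimes> a [^] i"
      using nat_pow_comm[of a i 1] by (simp add: m_assoc flip: nat_pow_Suc2)
    also have "\<dots> = z \<otimes> (a [^] i \<otimes> b \<otimes> a [^] i)"
      using z_pow_a_pow[of 1 i] by (simp add: a_b_a flip: m_assoc)
    also have "\<dots> = z [^] Suc i \<otimes> b"
      using nat_pow_comm[of z i 1] unfolding Suc by (simp flip: m_assoc)
    finally show ?case .
  qed simp
  have "c \<otimes> b \<otimes> c = a [^] i \<otimes> (z [^] k \<otimes> (b \<otimes> a [^] i)) \<otimes> z [^] k"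
    by (simp add: c m_assoc)
  also have "z [^] k \<otimes> (b \<otimes> a [^] i) = b \<otimes> a [^] i \<otimes> z [^] k"
    using z_comm[OF b_closed z_b, of k] z_pow_a_pow[of k i] by (simp add: m_assoc flip: m_assoc[of "z [^] k"])
  also have "a [^] i \<otimes> (b \<otimes> a [^] i \<otimes> z [^] k) \<otimes> z [^] k = a [^] i \<otimes> b \<otimes> a [^] i \<otimes> z [^] (k + k)"
    by (simp add: m_assoc nat_pow_mult)
  also have "\<dots> = z [^] (i + (k + k)) \<otimes> b"
    unfolding a_pow_b using z_comm[OF b_closed z_b, of "k + k"] by (simp add: m_assoc flip: nat_pow_mult)
  finally show ?thesis
    by (rule that)
qed

lemma b_mult_A:
  assumes "c \<in> A"
  shows "\<exists>d\<in>A. b \<otimes> c = d \<otimes> b"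
proof -
  obtain j :: nat where j: "c \<otimes> b \<otimes> c = z [^] j \<otimes> b"
    using b_twists_A[OF assms] .
  have "b \<otimes> c = inv c \<otimes> (c \<otimes> b \<otimes> c)"
    using assms by (simp add: m_assoc inv_solve_left)
  also have "\<dots> = (inv c \<otimes> z [^] j) \<otimes> b"
    using assms by (simp add: j m_assoc)
  finally have "b \<otimes> c = (inv c \<otimes> z [^] j) \<otimes> b" .
  moreover have "z [^] j \<in> A"
    using A_memI[of 0 j] by simp
  ultimately show ?thesis
    using subgroup.m_inv_closed[OF subgroup_A assms] subgroup.m_closed[OF subgroup_A] by blast
qed

lemma mem_A_or_coset:
  assumes "x \<in> carrier G"
  shows "x \<in> A \<or> (\<exists>c\<in>A. x = c \<otimes> b)"
proof -
  have mult_A: "c \<otimes> d \<in> A" if "c \<in> A" "d \<in> A" for c d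
    using subgroup.m_closed[OF subgroup_A that] .
  have coset: "c \<otimes> b \<otimes> d \<in> (\<lambda>c. c \<otimes> b) ` A" if "c \<in> A" "d \<in> A" for c d
  proof -
    obtain e where "e \<in> A" "b \<otimes> d = e \<otimes> b"
      using b_mult_A \<open>d \<in> A\<close> by blast
    then have "c \<otimes> b \<otimes> d = (c \<otimes> e) \<otimes> b"
      using that by (simp add: m_assoc)
    then show ?thesis
      using mult_A[OF \<open>c \<in> A\<close> \<open>e \<in> A\<close>] by blast
  qed
  have "x \<in> generate G {a, b}"
    using assms generated by simp
  then have "x \<in> A \<union> (\<lambda>c. c \<otimes> b) ` A"
  proof induction
    case one
    then show ?case
      using subgroup.one_closed[OF subgroup_A] by blast
  next
    case (incl h)
    moreover have "b \<in> (\<lambda>c. c \<otimes> b) ` A"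
      using subgroup.one_closed[OF subgroup_A] by (intro image_eqI[of _ _ \<one>]) simp_all
    ultimately show ?case
      using a_mem_A by blast
  next
    case (inv h)
    moreover have "inv b \<in> (\<lambda>c. c \<otimes> b) ` A"
      using z_mem_A inv_b by blast
    ultimately show ?case
      using subgroup.m_inv_closed[OF subgroup_A a_mem_A] by blast
  next
    case (eng h1 h2)
    have left: "c \<otimes> (d \<otimes> b) \<in> (\<lambda>c. c \<otimes> b) ` A" if "c \<in> A" "d \<in> A" for c d
      using mult_A[OF that] that by (intro image_eqI[of _ _ "c \<otimes> d"]) (simp_all add: m_assoc)
    have both: "c \<otimes> b \<otimes> (d \<otimes> b) \<in> A" if cd: "c \<in> A" "d \<in> A" for c d
    proof -
      obtain e where e: "e \<in> A" "c \<otimes> b \<otimes> d = e \<otimes> b"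
        using coset[OF cd] by blast
      have "c \<otimes> b \<otimes> (d \<otimes> b) = (c \<otimes> b \<otimes> d) \<otimes> b"
        using cd by (simp add: m_assoc)
      also have "\<dots> = e \<otimes> z"
        using e by (simp add: z_def m_assoc)
      finally show ?thesis
        using mult_A[OF \<open>e \<in> A\<close> z_mem_A] by simp
    qed
    show ?case
      using eng.IH by (elim UnE imageE) (simp_all add: mult_A coset left both)
  qed
  then show ?thesis
    by blast
qed

lemma finite_carrier: "finite (carrier G)"
proof -
  have a_red: "a [^] i = a [^] (i mod (2 * n))" for i
  proof -
    have "a [^] i = a [^] (2 * n * (i div (2 * n)) + i mod (2 * n))"
      by simp
    also have "\<dots> = (a [^] (2 * n)) [^] (i div (2 * n)) \<otimes> a [^] (i mod (2 * n))"
      by (simp only: nat_pow_mult nat_pow_pow a_closed)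
    finally show ?thesis
      by (simp add: a_pow)
  qed
  have "A \<subseteq> (\<lambda>(i, y). a [^] i \<otimes> y) ` ({..<2 * n} \<times> {\<one>, z})"
  proof
    fix c assume "c \<in> A"
    then obtain i k :: nat where "c = a [^] i \<otimes> z [^] k"
      by (auto simp: A_def)
    then have "c = a [^] (i mod (2 * n)) \<otimes> z [^] k"
      using a_red[of i] by metis
    then show "c \<in> (\<lambda>(i, y). a [^] i \<otimes> y) ` ({..<2 * n} \<times> {\<one>, z})"
      using z_pow_cases[of k] n_pos
      by (intro image_eqI[of _ _ "(i mod (2 * n), z [^] k)"]) auto
  qed
  then have "finite A"
    by (rule finite_subset) simp
  moreover have "carrier G \<subseteq> A \<union> (\<lambda>c. c \<otimes> b) ` A"
    using mem_A_or_coset by blast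
  ultimately show ?thesis
    by (meson finite_UnI finite_imageI finite_subset)
qed

lemma commutation_transitive: "commutation_transitive G"
proof (rule commutation_transitive_if_abelian_index_two[OF subgroup_A A_comm])
  fix x y assume "x \<in> carrier G - A" "y \<in> carrier G - A"
  then obtain c d where cd: "c \<in> A" "d \<in> A" "x = c \<otimes> b" "y = d \<otimes> b"
    using mem_A_or_coset by blast
  have "b \<otimes> (inv b \<otimes> inv d) = inv d"
    using cd(2) by (simp flip: m_assoc)
  then have "x \<otimes> inv y = c \<otimes> inv d"
    using cd(1,2) unfolding cd(3,4) by (simp add: inv_mult_group m_assoc)
  moreover have "c \<otimes> inv d \<in> A"
    using cd(1) subgroup.m_inv_closed[OF subgroup_A cd(2)] by (rule subgroup.m_closed[OF subgroup_A])
  ultimately show "x \<otimes> inv y \<in> A"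
    by simp
qed

lemma square_outside_A:
  assumes "x \<in> carrier G" "x \<notin> A"
  shows "x \<otimes> x = \<one> \<or> x \<otimes> x = z"
proof -
  obtain c where c: "c \<in> A" "x = c \<otimes> b"
    using mem_A_or_coset assms by blast
  obtain j :: nat where "c \<otimes> b \<otimes> c = z [^] j \<otimes> b"
    using b_twists_A[OF c(1)] .
  then have "x \<otimes> x = z [^] j \<otimes> z"
    using c(1) unfolding c(2) by (simp add: z_def flip: m_assoc)
  then have "x \<otimes> x = z [^] Suc j"
    by simp
  then show ?thesis
    using z_pow_cases[of "Suc j"] by simp
qed

text \<open>
  Squares outside \<open>A\<close> are \<open>\<one>\<close> or \<open>z\<close>. If \<open>z = \<one>\<close>, then every element outside \<open>A\<close> is an involution.
  Otherwise \<open>z\<close> puts the order 2 into \<open>A\<close>, so that only elements with square \<open>z\<close>, which have order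
  4, can have an order missing from \<open>A\<close>.
\<close>
lemma ord_eq_outside_A:
  assumes "x \<in> carrier G" "y \<in> carrier G" and "ord x \<notin> ord ` A" "ord y \<notin> ord ` A"
  shows "ord x = ord y"
proof -
  have ord_two: "ord w = 2" if "w \<in> carrier G" "w \<otimes> w = \<one>" "w \<noteq> \<one>" for w
  proof -
    have "ord w dvd 2" "ord w \<noteq> 1"
      using that pow_eq_id[of w 2] ord_eq_1[of w] by (simp_all add: numeral_2_eq_2)
    then show ?thesis
      by (metis One_nat_def dvd_imp_le less_2_cases_iff le_neq_implies_less pos2 dvd_0_left_iff zero_neq_numeral)
  qed
  have not_A: "w \<notin> A" "w \<noteq> \<one>" if "ord w \<notin> ord ` A" for w
    using that subgroup.one_closed[OF subgroup_A] by auto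
  define q :: nat where "q = (if z = \<one> then 2 else 4)"
  have ord_q: "ord w = q" if w: "w \<in> carrier G" "ord w \<notin> ord ` A" for w
  proof (cases "z = \<one>")
    case True
    then show ?thesis
      using ord_two[OF w(1)] square_outside_A[OF w(1)] not_A[OF w(2)] by (auto simp: q_def)
  next
    case False
    then have "ord z = 2"
      using ord_two[OF z_closed] z_z by simp
    then have "ord w \<noteq> 2"
      using z_mem_A w(2) by (metis image_eqI)
    then have sq: "w \<otimes> w = z"
      using ord_two[OF w(1)] square_outside_A[OF w(1)] not_A[OF w(2)] by blast
    have "ord w dvd 4"
      using w(1) sq z_z pow_eq_id[of w 4] by (simp add: numeral_eq_Suc m_assoc)
    moreover have "\<not> ord w dvd 2"
      using w(1) sq False pow_eq_id[of w 2] by (simp add: numeral_2_eq_2)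
    moreover have "k = 4" if "k dvd 4" "\<not> k dvd 2" for k :: nat
    proof -
      have "k \<le> 4"
        using that(1) by (rule dvd_imp_le) simp
      then have "k \<in> {0, 1, 2, 3, 4}"
        by auto
      then show ?thesis
        using that by auto
    qed
    ultimately show ?thesis
      using False by (simp add: q_def)
  qed
  show ?thesis
    using ord_q[OF assms(1,3)] ord_q[OF assms(2,4)] by simp
qed

end

lemma inv_pres_class_Gen:
  "inv\<^bsub>presented_group R\<^esub> (pres_class R [Gen x]) = pres_class R [Inv x]"
proof (rule group.inv_equality[OF group_presented_group])
  show "pres_class R [Inv x] \<otimes>\<^bsub>presented_group R\<^esub> pres_class R [Gen x] =
      \<one>\<^bsub>presented_group R\<^esub>"
    using pres_eq.inv_gen[of R x]
    by (simp add: presented_group_mult pres_class_eq_iff) (simp add: presented_group_def pres_class_eq_iff)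
qed (simp_all add: presented_group_def)

lemma pow_pres_class_Gen:
  "pres_class R [Gen x] [^]\<^bsub>presented_group R\<^esub> k = pres_class R (replicate k (Gen x))"
proof (induction k)
  case 0
  show ?case
    by (simp add: presented_group_def)
next
  case (Suc k)
  then show ?case
    by (simp add: presented_group_mult replicate_append_same)
qed

lemma generate_presented_group:
  "carrier (presented_group R) = generate (presented_group R) (range (\<lambda>x. pres_class R [Gen x]))"
    (is "carrier ?G = generate ?G ?gens")
proof
  interpret group ?G
    by (rule group_presented_group)
  have carr: "pres_class R u \<in> carrier ?G" for u
    by (simp add: presented_group_def)
  show "generate ?G ?gens \<subseteq> carrier ?G"
    using carr by (intro generate_incl) blast
  have "pres_class R u \<in> generate ?G ?gens" for u
  proof (induction u)
    case Nil
    have "pres_class R [] = \<one>\<^bsub>?G\<^esub>"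
      by (simp add: presented_group_def)
    then show ?case
      using generate.one by simp
  next
    case (Cons l u)
    have "pres_class R [l] \<in> generate ?G ?gens"
    proof (cases l)
      case (Gen x)
      then show ?thesis
        by (auto intro: generate.incl)
    next
      case (Inv x)
      then show ?thesis
        using generate.inv[of "pres_class R [Gen x]" ?gens ?G] by (simp add: inv_pres_class_Gen)
    qed
    then have "pres_class R [l] \<otimes>\<^bsub>?G\<^esub> pres_class R u \<in> generate ?G ?gens"
      using Cons.IH by (rule generate.eng)
    then show ?case
      by (simp add: presented_group_mult)
  qed
  then show "carrier ?G \<subseteq> generate ?G ?gens"
    by (auto simp: presented_group_def)
qed

lemma V8_relations_V8:
  assumes "n \<ge> 1"
  shows "\<exists>a b. V8_relations (V8 n) a b n"
proof -
  define R where "R =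
     {(replicate (2 * n) (Gen gen_a), []),
      (replicate 4 (Gen gen_b), []),
      ([Gen gen_b, Gen gen_a], [Inv gen_a, Inv gen_b]),
      ([Inv gen_b, Gen gen_a], [Inv gen_a, Gen gen_b])}"
  have rel: "pres_class R u = pres_class R v" if "(u, v) \<in> R" for u v
    unfolding pres_class_eq_iff by (rule pres_eq.rel[OF that])
  have one: "\<one>\<^bsub>presented_group R\<^esub> = pres_class R []"
    by (simp add: presented_group_def)
  have gens: "range (\<lambda>x. pres_class R [Gen x]) = {pres_class R [Gen gen_a], pres_class R [Gen gen_b]}"
  proof (intro equalityI subsetI)
    fix X assume "X \<in> range (\<lambda>x. pres_class R [Gen x])"
    then obtain x where "X = pres_class R [Gen x]"
      by blast
    then show "X \<in> {pres_class R [Gen gen_a], pres_class R [Gen gen_b]}"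
      by (cases x) simp_all
  qed blast
  have "V8_relations (presented_group R) (pres_class R [Gen gen_a]) (pres_class R [Gen gen_b]) n"
  proof (intro V8_relations.intro V8_relations_axioms.intro group_presented_group)
    show "carrier (presented_group R) =
        generate (presented_group R) {pres_class R [Gen gen_a], pres_class R [Gen gen_b]}"
      using generate_presented_group[of R] unfolding gens .
    show "pres_class R [Gen gen_a] [^]\<^bsub>presented_group R\<^esub> (2 * n) = \<one>\<^bsub>presented_group R\<^esub>"
      unfolding one pow_pres_class_Gen by (rule rel) (simp add: R_def)
    show "pres_class R [Gen gen_b] [^]\<^bsub>presented_group R\<^esub> (4 :: nat) = \<one>\<^bsub>presented_group R\<^esub>"
      unfolding one pow_pres_class_Gen by (rule rel) (simp add: R_def)
    show "pres_class R [Gen gen_b] \<otimes>\<^bsub>presented_group R\<^esub> pres_class R [Gen gen_a] =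
        inv\<^bsub>presented_group R\<^esub> pres_class R [Gen gen_a] \<otimes>\<^bsub>presented_group R\<^esub>
        inv\<^bsub>presented_group R\<^esub> pres_class R [Gen gen_b]"
      unfolding inv_pres_class_Gen presented_group_mult by (rule rel) (simp add: R_def)
    show "inv\<^bsub>presented_group R\<^esub> pres_class R [Gen gen_b] \<otimes>\<^bsub>presented_group R\<^esub> pres_class R [Gen gen_a] =
        inv\<^bsub>presented_group R\<^esub> pres_class R [Gen gen_a] \<otimes>\<^bsub>presented_group R\<^esub> pres_class R [Gen gen_b]"
      unfolding inv_pres_class_Gen presented_group_mult by (rule rel) (simp add: R_def)
  qed (use assms in \<open>simp_all add: presented_group_def\<close>)
  then show ?thesis
    unfolding V8_def R_def by blast
qed

theorem theorem3p4:
  fixes n :: nat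
  assumes "n \<ge> 1"
  shows "hansen_vukicevic (ESCom (V8 n)) \<and>
         hansen_vukicevic (CSCom (V8 n)) \<and>
         hansen_vukicevic (OSCom (V8 n))"
proof -
  obtain a b where "V8_relations (V8 n) a b n"
    using V8_relations_V8[OF assms] by blast
  then interpret V8_relations "V8 n" a b n .
  show ?thesis
  proof (intro conjI)
    show "hansen_vukicevic (ESCom (V8 n))"
      by (rule hansen_vukicevic_ESCom[OF finite_carrier commutation_transitive])
    show "hansen_vukicevic (CSCom (V8 n))"
      by (rule hansen_vukicevic_CSCom[OF finite_carrier commutation_transitive])
    show "hansen_vukicevic (OSCom (V8 n))"
      by (rule hansen_vukicevic_OSCom[OF finite_carrier subgroup.subset[OF subgroup_A] A_comm ord_eq_outside_A])
  qed
qed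

end
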